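(* Let $\mathcal{S}=\langle\mathcal{L},\vdash\rangle$ be a logic (with $\mathcal{L}$ a formula algebra over a denumerable set of variables $V$) having a falsity constant $\bot\in\mathcal{L}$. Then the left variable inclusion companion $\mathcal{S}^l=\langle\mathcal{L},\vdash^l\rangle$ and the pure left variable inclusion companion $\mathcal{S}^{pl}=\langle\mathcal{L},\vdash^{pl}\rangle$ are not NF-paraconsistent.
   Context: A logic is a pair $\langle\mathcal{L},\vdash\rangle$ with $\vdash\,\subseteq\mathcal{P}(\mathcal{L})\times\mathcal{L}$, and $C_\vdash(\Gamma)=\{\alpha:\Gamma\vdash\alpha\}$. Here $\mathcal{L}$ is the set of formulas built inductively over a denumerable set $V$ of variables using a finite set of connectives (possibly including nullary ones). For $\alpha\in\mathcal{L}$, $\mathrm{var}(\alpha)$ is the set of variables occurring in $\alpha$, and $\mathrm{var}(\Delta)=\bigcup_{\alpha\in\Delta}\mathrm{var}(\alpha)$. A falsity constant is a constant $\bot\in\mathcal{L}$ (so $\mathrm{var}(\bot)=\emptyset$) such that $\{\bot\}\vdash\alpha$ for all $\alpha\in\mathcal{L}$. The relation $\vdash^l$: $\Gamma\vdash^l\alpha$ iff there is $\Delta\subseteq\Gamma$ with $\mathrm{var}(\Delta)\subseteq\mathrm{var}(\alpha)$ and $\Delta\vdash\alpha$. The relation $\vdash^{pl}$: $\Gamma\vdash^{pl}\alpha$ iff there is a nonempty $\Delta\subseteq\Gamma$ with $\mathrm{var}(\Delta)\subseteq\mathrm{var}(\alpha)$ and $\Delta\vdash\alpha$. A logic $\langle\mathcal{L},\vdash\rangle$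 is NF-paraconsistent if there exists $\alpha\in\mathcal{L}$ such that $C_\vdash(\{\alpha,\beta\})\neq\mathcal{L}$ for every $\beta\in\mathcal{L}$. *)

theory Defs
  imports Main "HOL-Library.Countable_Set"
begin

datatype (dead 'c, var: 'v) fm = Var 'v | App 'c "('c, 'v) fm list"

inductive_set formulas :: "'c set \<Rightarrow> ('c \<Rightarrow> nat) \<Rightarrow> 'v set \<Rightarrow> ('c, 'v) fm set"
  for C :: "'c set" and ar :: "'c \<Rightarrow> nat" and V :: "'v set" where
  Var: "v \<in> V \<Longrightarrow> Var v \<in> formulas C ar V"
| App: "c \<in> C \<Longrightarrow> length ts = ar c \<Longrightarrow> \<forall>t\<in>set ts. t \<in> formulas C ar V
        \<Longrightarrow> App c ts \<in> formulas C ar V"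

definition var_of_set :: "('c, 'v) fm set \<Rightarrow> 'v set" where
  "var_of_set \<Delta> = (\<Union>\<alpha>\<in>\<Delta>. var \<alpha>)"

text \<open>A consequence relation is a set of pairs \<open>(\<Gamma>, \<alpha>)\<close>, with no closure conditions required.\<close>

definition logic :: "'a set \<Rightarrow> ('a set \<times> 'a) set \<Rightarrow> bool" where
  "logic L R \<longleftrightarrow> R \<subseteq> Pow L \<times> L"

definition Cn :: "('a set \<times> 'a) set \<Rightarrow> 'a set \<Rightarrow> 'a set" where
  "Cn R \<Gamma> = {\<alpha>. (\<Gamma>, \<alpha>) \<in> R}"

definition falsity_constant ::
    "'c set \<Rightarrow> ('c \<Rightarrow> nat) \<Rightarrow> 'v set \<Rightarrow> (('c, 'v) fm set \<times> ('c, 'v) fm) set \<Rightarrow> ('c, 'v) fm \<Rightarrow> bool" where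
  "falsity_constant C ar V R b \<longleftrightarrow>
     (\<exists>c\<in>C. ar c = 0 \<and> b = App c []) \<and> (\<forall>\<alpha>\<in>formulas C ar V. ({b}, \<alpha>) \<in> R)"

definition left_companion ::
    "('c, 'v) fm set \<Rightarrow> (('c, 'v) fm set \<times> ('c, 'v) fm) set \<Rightarrow> (('c, 'v) fm set \<times> ('c, 'v) fm) set" where
  "left_companion L R =
     {(\<Gamma>, \<alpha>). \<Gamma> \<subseteq> L \<and> \<alpha> \<in> L \<and> (\<exists>\<Delta>\<subseteq>\<Gamma>. var_of_set \<Delta> \<subseteq> var \<alpha> \<and> (\<Delta>, \<alpha>) \<in> R)}"

definition pure_left_companion ::
    "('c, 'v) fm set \<Rightarrow> (('c, 'v) fm set \<times> ('c, 'v) fm) set \<Rightarrow> (('c, 'v) fm set \<times> ('c, 'v) fm) set" where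
  "pure_left_companion L R =
     {(\<Gamma>, \<alpha>). \<Gamma> \<subseteq> L \<and> \<alpha> \<in> L \<and>
        (\<exists>\<Delta>\<subseteq>\<Gamma>. \<Delta> \<noteq> {} \<and> var_of_set \<Delta> \<subseteq> var \<alpha> \<and> (\<Delta>, \<alpha>) \<in> R)}"

definition NF_paraconsistent :: "'a set \<Rightarrow> ('a set \<times> 'a) set \<Rightarrow> bool" where
  "NF_paraconsistent L R \<longleftrightarrow> (\<exists>\<alpha>\<in>L. \<forall>\<beta>\<in>L. Cn R {\<alpha>, \<beta>} \<noteq> L)"

lemma logic_left_companion: "logic L (left_companion L R)"
  by (auto simp: logic_def left_companion_def)

lemma logic_pure_left_companion: "logic L (pure_left_companion L R)"
  by (auto simp: logic_def pure_left_companion_def)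

end

theory Submission imports Defs begin

text \<open>A falsity constant explodes on its own, and it contains no variables, so as a set of
  premises \<open>{falsum}\<close> meets the variable inclusion condition for every conclusion.
  Passing to a companion therefore cannot destroy this explosion: any premise set containing
  \<open>falsum\<close> still proves every formula. Hence each \<alpha> is trivialised by adding the
  same \<beta>, namely \<open>falsum\<close>. The core is
  \<open>pure_left_companion_explosion\<close>; the other companion inherits it by
  inclusion.\<close>

lemma falsity_constant_in_formulas:
  assumes "falsity_constant C ar V R b"
  shows "b \<in> formulas C ar V"
  using assms by (auto simp: falsity_constant_def intro: formulas.App)

lemma var_of_set_falsity_constant:
  assumes "falsity_constant C ar V R b"
  shows "var_of_set {b} = {}"
  using assms by (auto simp: falsity_constant_def var_of_set_def)

lemma pure_left_companion_subset_left_companion: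
  "pure_left_companion L R \<subseteq> left_companion L R"
  by (auto simp: pure_left_companion_def left_companion_def)

text \<open>Having no variables, the falsity constant passes every variable inclusion test.\<close>

lemma pure_left_companion_explosion:
  assumes b: "falsity_constant C ar V R b"
    and "b \<in> \<Gamma>" "\<Gamma> \<subseteq> formulas C ar V" "\<beta> \<in> formulas C ar V"
  shows "(\<Gamma>, \<beta>) \<in> pure_left_companion (formulas C ar V) R"
proof -
  \<comment> \<open>The singleton \<open>{b}\<close> serves as \<Delta>; being nonempty, it is
    admissible even for the pure companion.\<close>
  have "{b} \<subseteq> \<Gamma>" "{b} \<noteq> {}" "var_of_set {b} \<subseteq> var \<beta>" "({b}, \<beta>) \<in> R"
    using assms var_of_set_falsity_constant[OF b] by (auto simp: falsity_constant_def)
  then show ?thesis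
    using assms(3,4) unfolding pure_left_companion_def by blast
qed

text \<open>One \<open>b\<close> refutes every candidate \<alpha> at once. The third assumption
  gives \<open>L\<close> as a lower bound for the consequences, and \<open>logic L R\<close> keeps
  them inside \<open>L\<close>.\<close>

lemma not_NF_paraconsistentI:
  assumes "logic L R" "b \<in> L"
    and "\<And>\<alpha> \<beta>. \<alpha> \<in> L \<Longrightarrow> \<beta> \<in> L \<Longrightarrow> ({\<alpha>, b}, \<beta>) \<in> R"
  shows "\<not> NF_paraconsistent L R"
proof -
  have "Cn R {\<alpha>, b} = L" if "\<alpha> \<in> L" for \<alpha>
    using assms that by (auto simp: Cn_def logic_def)
  then show ?thesis
    using assms(2) by (auto simp: NF_paraconsistent_def)
qed

theorem theorem2p13:
  fixes C :: "'c set" and ar :: "'c \<Rightarrow> nat" and V :: "'v set"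
    and R :: "(('c, 'v) fm set \<times> ('c, 'v) fm) set" and falsum :: "('c, 'v) fm"
  assumes "finite C"
    and "countable V" and "infinite V"
    and "logic (formulas C ar V) R"
    and "falsity_constant C ar V R falsum"
  shows "\<not> NF_paraconsistent (formulas C ar V) (left_companion (formulas C ar V) R)
       \<and> \<not> NF_paraconsistent (formulas C ar V) (pure_left_companion (formulas C ar V) R)"
proof -
  let ?L = "formulas C ar V"
  have falsum: "falsum \<in> ?L"
    using assms(5) by (rule falsity_constant_in_formulas)
  have pure: "({\<alpha>, falsum}, \<beta>) \<in> pure_left_companion ?L R" if "\<alpha> \<in> ?L" "\<beta> \<in> ?L" for \<alpha> \<beta>
    using assms(5) falsum that by (intro pure_left_companion_explosion) auto
  then have left: "({\<alpha>, falsum}, \<beta>) \<in> left_companion ?L R" if "\<alpha> \<in> ?L" "\<beta> \<in> ?L" for \<alpha> \<beta>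
    using that pure_left_companion_subset_left_companion by blast
  show ?thesis
    using not_NF_paraconsistentI[OF logic_left_companion falsum left]
      not_NF_paraconsistentI[OF logic_pure_left_companion falsum pure] by blast
qed

end
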